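(* For every real number $c<4$ there exists an integer $n_0$ such that $\text{sat}^*(n, \mathcal D_2)\geq c\sqrt n$ for every $n\geq n_0$.
   Context: All families considered are families of subsets of $[n]=\{1,\dots,n\}$, partially ordered by inclusion. The diamond poset $\mathcal D_2$ is the 4-element poset with one minimal element, one maximal element and two incomparable middle elements (the two-dimensional Boolean lattice). A family $\mathcal F$ contains an induced copy of $\mathcal D_2$ if there are four distinct sets $W,X,Y,Z\in\mathcal F$ with $W\subset X\subset Z$, $W\subset Y\subset Z$ and $X,Y$ incomparable under inclusion. A family $\mathcal F$ of subsets of $[n]$ is $\mathcal D_2$-saturated if it contains no induced copy of $\mathcal D_2$, but for every subset $S\subseteq[n]$ with $S\notin\mathcal F$, the family $\mathcal F\cup\{S\}$ contains an induced copy of $\mathcal D_2$. $\text{sat}^*(n,\mathcal D_2)$ denotes the minimum size of a $\mathcal D_2$-saturated family of subsets of $[n]$. *)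

theory Defs
  imports Complex_Main
begin

definition has_induced_diamond :: "nat set set \<Rightarrow> bool" where
  "has_induced_diamond F \<longleftrightarrow>
     (\<exists>W\<in>F. \<exists>X\<in>F. \<exists>Y\<in>F. \<exists>Z\<in>F. distinct [W, X, Y, Z] \<and>
        W \<subset> X \<and> X \<subset> Z \<and> W \<subset> Y \<and> Y \<subset> Z \<and> \<not> X \<subseteq> Y \<and> \<not> Y \<subseteq> X)"

definition diamond_saturated :: "nat \<Rightarrow> nat set set \<Rightarrow> bool" where
  "diamond_saturated n F \<longleftrightarrow>
     F \<subseteq> Pow {1..n} \<and> \<not> has_induced_diamond F \<and>
     (\<forall>S. S \<subseteq> {1..n} \<and> S \<notin> F \<longrightarrow> has_induced_diamond (insert S F))"

definition sat_star_diamond :: "nat \<Rightarrow> nat" where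
  "sat_star_diamond n = Min {card F | F. diamond_saturated n F}"

text \<open>The minimum is taken over a finite nonempty set.\<close>

lemma finite_card_diamond_saturated: "finite {card F | F. diamond_saturated n F}"
proof (rule finite_subset)
  show "{card F | F. diamond_saturated n F} \<subseteq> card ` Pow (Pow {1..n})"
    by (auto simp: diamond_saturated_def)
qed simp

lemma diamond_saturated_exists: "\<exists>F. diamond_saturated n F"
proof -
  define A where "A = {F. F \<subseteq> Pow {1..n} \<and> \<not> has_induced_diamond F}"
  have fin: "finite A"
    unfolding A_def by (rule finite_subset[of _ "Pow (Pow {1..n})"]) auto
  have "{} \<in> A"
    by (simp add: A_def has_induced_diamond_def)
  then have "A \<noteq> {}" by blast
  from finite_has_maximal[OF fin this] obtain F
    where F: "F \<in> A" and max: "\<forall>G\<in>A. F \<subseteq> G \<longrightarrow> F = G" by (elim bexE)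
  have "has_induced_diamond (insert S F)" if S: "S \<subseteq> {1..n}" "S \<notin> F" for S
  proof (rule ccontr)
    assume "\<not> has_induced_diamond (insert S F)"
    then have "insert S F \<in> A" using F S(1) by (simp add: A_def)
    with max have "F = insert S F" by (simp add: subset_insertI)
    with S(2) show False by (metis insertI1)
  qed
  with F have "diamond_saturated n F"
    by (simp add: A_def diamond_saturated_def)
  then show ?thesis ..
qed

lemma card_diamond_saturated_nonempty: "{card F | F. diamond_saturated n F} \<noteq> {}"
  using diamond_saturated_exists by auto

end

theory Submission
  imports Defs
begin

text \<open>
  Let \<open>F\<close> be saturated. Removing a point from a minimal member \<open>W\<close> of \<open>F\<close> yields a set that can only
  be the bottom of a new diamond; this forces \<open>card W \<le> card F\<close>. If \<open>M\<close> is a maximal set that is the bottom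
  of a diamond whose other members lie in \<open>F\<close>, then each point \<open>i\<close> outside \<open>M\<close> is the only point outside
  \<open>M\<close> of some minimal member. So \<open>M\<close> misses at most \<open>card F\<close> points, and every \<open>i\<close> lying in some minimal
  member satisfies \<open>W - X = {i}\<close> for a minimal \<open>W\<close> and a non-maximal \<open>X\<close> with at least \<open>n - card F\<close>
  points. At most \<open>card F\<close> points lie in no minimal member, since above a fixed minimal member \<open>F\<close> is a
  tree in which every such point is added on its own at some step. Hence \<open>n - card F \<le> a * l\<close>
  with \<open>a\<close> and \<open>l\<close> the numbers of minimal and of large non-maximal members. Dually
  \<open>n - card F \<le> b * m\<close> for the maximal and the small non-minimal members. These four classes are
  disjoint when \<open>2 * card F < n\<close>, so AM-GM gives \<open>card F \<ge> 4 * sqrt (n - card F)\<close>.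
\<close>

section \<open>Extremal members and diamonds\<close>

definition minimal_members :: "'a set set \<Rightarrow> 'a set set" where
  "minimal_members F = {W \<in> F. \<forall>V\<in>F. \<not> V \<subset> W}"

definition maximal_members :: "'a set set \<Rightarrow> 'a set set" where
  "maximal_members F = {Z \<in> F. \<forall>V\<in>F. \<not> Z \<subset> V}"

lemma minimal_members_subset: "minimal_members F \<subseteq> F"
  and maximal_members_subset: "maximal_members F \<subseteq> F"
  by (simp_all add: minimal_members_def maximal_members_def)

text \<open>\<open>S\<close> need not belong to \<open>F\<close>: it can serve as the bottom of a
  diamond whose other three sets are members. Non-strict inclusions suffice, since incomparability
  of \<open>X\<close> and \<open>Y\<close> makes them strict, and they keep the notion closed under
  passing to subsets.\<close>

definition diamond_bottom :: "'a set set \<Rightarrow> 'a set \<Rightarrow> bool" where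
  "diamond_bottom F S \<longleftrightarrow> (\<exists>X\<in>F. \<exists>Y\<in>F. \<exists>Z\<in>F. S \<subseteq> X \<and> S \<subseteq> Y \<and> X \<subset> Z \<and> Y \<subset> Z
     \<and> \<not> X \<subseteq> Y \<and> \<not> Y \<subseteq> X)"

lemma has_induced_diamond_iff:
  "has_induced_diamond F \<longleftrightarrow>
     (\<exists>W\<in>F. \<exists>X\<in>F. \<exists>Y\<in>F. \<exists>Z\<in>F. W \<subseteq> X \<and> X \<subseteq> Z \<and> W \<subseteq> Y \<and> Y \<subseteq> Z \<and> \<not> X \<subseteq> Y \<and> \<not> Y \<subseteq> X)"
  (is "?L \<longleftrightarrow> ?R")
proof
  assume ?L
  then show ?R unfolding has_induced_diamond_def by (meson psubset_imp_subset)
next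
  assume ?R
  then obtain W X Y Z where *: "W \<in> F" "X \<in> F" "Y \<in> F" "Z \<in> F" "W \<subseteq> X" "X \<subseteq> Z" "W \<subseteq> Y" "Y \<subseteq> Z"
    "\<not> X \<subseteq> Y" "\<not> Y \<subseteq> X" by blast
  then have "W \<subset> X" "X \<subset> Z" "W \<subset> Y" "Y \<subset> Z" "distinct [W, X, Y, Z]" by auto
  with * show ?L unfolding has_induced_diamond_def by blast
qed

lemma diamond_bottom_antimono: "diamond_bottom F S \<Longrightarrow> T \<subseteq> S \<Longrightarrow> diamond_bottom F T"
  unfolding diamond_bottom_def by (meson subset_trans)

lemma diamond_free_not_bottom: "\<not> has_induced_diamond F \<Longrightarrow> S \<in> F \<Longrightarrow> \<not> diamond_bottom F S"
  unfolding diamond_bottom_def has_induced_diamond_iff by (meson psubset_imp_subset)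

text \<open>Incomparable \<open>A\<close> and \<open>B\<close> would be the middle of a diamond.
  This is the tree structure of \<open>F\<close> above a member \<open>V\<close>.\<close>

lemma diamond_free_interval_chain:
  assumes "\<not> has_induced_diamond F" "V \<in> F" "A \<in> F" "B \<in> F" "Z \<in> F"
    "V \<subseteq> A" "V \<subseteq> B" "A \<subseteq> Z" "B \<subseteq> Z"
  shows "A \<subseteq> B \<or> B \<subseteq> A"
  using assms unfolding has_induced_diamond_iff by blast

section \<open>Duality under complementation\<close>

text \<open>Complementation reverses inclusion, and the diamond is isomorphic to its own dual:
  \<open>W\<close> and \<open>Z\<close> trade places.\<close>

lemma has_induced_diamond_complement:
  assumes "F \<subseteq> Pow E"
  shows "has_induced_diamond ((-) E ` F) \<longleftrightarrow> has_induced_diamond F"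
proof -
  have sub: "E - A \<subseteq> E - B \<longleftrightarrow> B \<subseteq> A" if "A \<in> F" "B \<in> F" for A B
    using that assms by blast
  show ?thesis
    unfolding has_induced_diamond_iff by (simp add: sub cong: bex_cong) blast
qed

lemma diamond_saturated_complement:
  assumes "diamond_saturated n F"
  shows "diamond_saturated n ((-) {1..n} ` F)"
  unfolding diamond_saturated_def
proof (intro conjI allI impI)
  have F: "F \<subseteq> Pow {1..n}" and free: "\<not> has_induced_diamond F"
    using assms by (auto simp: diamond_saturated_def)
  show "(-) {1..n} ` F \<subseteq> Pow {1..n}" by auto
  show "\<not> has_induced_diamond ((-) {1..n} ` F)"
    using free has_induced_diamond_complement[OF F] by simp
  fix S assume S: "S \<subseteq> {1..n} \<and> S \<notin> (-) {1..n} ` F"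
  have dd: "{1..n} - ({1..n} - S) = S" using S by blast
  have "{1..n} - S \<notin> F"
  proof
    assume "{1..n} - S \<in> F"
    then have "{1..n} - ({1..n} - S) \<in> (-) {1..n} ` F" by (rule imageI)
    with S dd show False by simp
  qed
  then have "has_induced_diamond (insert ({1..n} - S) F)"
    using assms by (auto simp: diamond_saturated_def)
  moreover have "insert ({1..n} - S) F \<subseteq> Pow {1..n}" using F by auto
  ultimately have "has_induced_diamond ((-) {1..n} ` insert ({1..n} - S) F)"
    using has_induced_diamond_complement by blast
  with dd show "has_induced_diamond (insert S ((-) {1..n} ` F))" by simp
qed

lemma minimal_members_complement:
  assumes "F \<subseteq> Pow E"
  shows "minimal_members ((-) E ` F) = (-) E ` maximal_members F"
proof -
  have "E - A \<subset> E - B \<longleftrightarrow> B \<subset> A" if "A \<in> F" "B \<in> F" for A B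
    using that assms by blast
  then have mem: "E - A \<in> minimal_members ((-) E ` F) \<longleftrightarrow> A \<in> maximal_members F" if "A \<in> F" for A
    using that by (simp add: minimal_members_def maximal_members_def)
  have "minimal_members ((-) E ` F) = (-) E ` {A \<in> F. E - A \<in> minimal_members ((-) E ` F)}"
    using minimal_members_subset[of "(-) E ` F"] by blast
  also have "{A \<in> F. E - A \<in> minimal_members ((-) E ` F)} = maximal_members F"
    using mem maximal_members_subset[of F] by blast
  finally show ?thesis .
qed

lemma maximal_members_complement:
  assumes "F \<subseteq> Pow E"
  shows "maximal_members ((-) E ` F) = (-) E ` minimal_members F"
proof -
  have "E - A \<subset> E - B \<longleftrightarrow> B \<subset> A" if "A \<in> F" "B \<in> F" for A B
    using that assms by blast
  then have mem: "E - A \<in> maximal_members ((-) E ` F) \<longleftrightarrow> A \<in> minimal_members F" if "A \<in> F" for A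
    using that by (simp add: minimal_members_def maximal_members_def)
  have "maximal_members ((-) E ` F) = (-) E ` {A \<in> F. E - A \<in> maximal_members ((-) E ` F)}"
    using maximal_members_subset[of "(-) E ` F"] by blast
  also have "{A \<in> F. E - A \<in> maximal_members ((-) E ` F)} = minimal_members F"
    using mem minimal_members_subset[of F] by blast
  finally show ?thesis .
qed

section \<open>Roles of a nonmember in the diamond it creates\<close>

locale saturated_family =
  fixes n :: nat and F :: "nat set set"
  assumes saturated: "diamond_saturated n F"
begin

lemma members_subset: "F \<subseteq> Pow {1..n}"
  and diamond_free: "\<not> has_induced_diamond F"
  using saturated by (auto simp: diamond_saturated_def)

lemma finite_members: "finite F"
  using members_subset finite_subset by blast

lemma finite_member: "S \<in> F \<Longrightarrow> finite S"
  using members_subset finite_subset by blast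

lemma nonmember_cases:
  assumes "S \<subseteq> {1..n}" "S \<notin> F"
  obtains (bottom) "diamond_bottom F S"
  | (middle) W X Z where "W \<in> F" "X \<in> F" "Z \<in> F" "W \<subset> S" "S \<subset> Z" "W \<subset> X" "X \<subset> Z"
      "\<not> S \<subseteq> X" "\<not> X \<subseteq> S"
  | (top) W X Y where "W \<in> F" "X \<in> F" "Y \<in> F" "W \<subset> X" "W \<subset> Y" "X \<subset> S" "Y \<subset> S"
      "\<not> X \<subseteq> Y" "\<not> Y \<subseteq> X"
proof -
  have "has_induced_diamond (insert S F)"
    using saturated assms by (auto simp: diamond_saturated_def)
  then obtain W X Y Z where ins: "W \<in> insert S F" "X \<in> insert S F" "Y \<in> insert S F" "Z \<in> insert S F"
    and d: "distinct [W, X, Y, Z]"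
    and o: "W \<subset> X" "X \<subset> Z" "W \<subset> Y" "Y \<subset> Z" "\<not> X \<subseteq> Y" "\<not> Y \<subseteq> X"
    unfolding has_induced_diamond_def by blast
  have "W = S \<or> X = S \<or> Y = S \<or> Z = S"
    using ins d o diamond_free unfolding has_induced_diamond_def by blast
  then consider "W = S" | "X = S" | "Y = S" | "Z = S" by blast
  then show thesis
  proof cases
    case 1
    then have "X \<in> F" "Y \<in> F" "Z \<in> F" using ins d by auto
    then have "diamond_bottom F S"
      using 1 o unfolding diamond_bottom_def by (meson psubset_imp_subset)
    then show thesis by (rule bottom)
  next
    case 2
    then have "W \<in> F" "Y \<in> F" "Z \<in> F" using ins d by auto
    then show thesis using 2 o by (intro middle[of W Y Z]) simp_all
  next
    case 3
    then have "W \<in> F" "X \<in> F" "Z \<in> F" using ins d by auto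
    then show thesis using 3 o by (intro middle[of W X Z]) simp_all
  next
    case 4
    then have "W \<in> F" "X \<in> F" "Y \<in> F" using ins d by auto
    then show thesis using 4 o by (intro top[of W X Y]) simp_all
  qed
qed

lemma minimal_member_below:
  assumes "S \<in> F"
  obtains W where "W \<in> minimal_members F" "W \<subseteq> S"
proof -
  obtain W where "W \<in> F" "W \<subseteq> S" "\<forall>V\<in>F. V \<subseteq> W \<longrightarrow> W = V"
    using finite_has_minimal2[OF finite_members assms] by metis
  then have "W \<in> minimal_members F" unfolding minimal_members_def by blast
  then show thesis using \<open>W \<subseteq> S\<close> by (rule that)
qed

lemma nonempty: "F \<noteq> {}"
proof
  assume "F = {}"
  then show False
    by (rule_tac nonmember_cases[of "{}"]) (auto simp: diamond_bottom_def)
qed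

text \<open>As a middle set or as the top of a new diamond, \<open>S\<close> has the bottom of that
  diamond, a member, below it.\<close>

lemma non_bottom_above_minimal_member:
  assumes "S \<subseteq> {1..n}" "\<not> diamond_bottom F S"
  obtains W where "W \<in> minimal_members F" "W \<subseteq> S"
proof (cases "S \<in> F")
  case True
  then show thesis by (rule minimal_member_below) (rule that)
next
  case False
  from assms(1) False have "\<exists>V\<in>F. V \<subseteq> S"
    by (cases rule: nonmember_cases) (use assms(2) in blast)+
  then obtain V where V: "V \<in> F" "V \<subseteq> S" by blast
  obtain W where W: "W \<in> minimal_members F" "W \<subseteq> V" using minimal_member_below[OF V(1)] .
  show thesis by (rule that[OF W(1)]) (use W(2) V(2) in blast)
qed

section \<open>Minimal members and maximal bottoms\<close>

text \<open>Nothing in \<open>F\<close> lies below \<open>W - {j}\<close>, so bottom is the only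
  role left for it.\<close>

lemma minimal_member_diff_bottom:
  assumes W: "W \<in> minimal_members F" and j: "j \<in> W"
  shows "diamond_bottom F (W - {j})"
proof (rule ccontr)
  assume "\<not> diamond_bottom F (W - {j})"
  moreover have "W - {j} \<subseteq> {1..n}"
    using W members_subset minimal_members_subset[of F] by blast
  ultimately obtain V where "V \<in> minimal_members F" "V \<subseteq> W - {j}"
    using non_bottom_above_minimal_member by blast
  then show False using W j by (auto simp: minimal_members_def)
qed

lemma card_minimal_member:
  assumes W: "W \<in> minimal_members F"
  shows "card W \<le> card F"
proof -
  have WF: "W \<in> F" using W by (simp add: minimal_members_def)
  have "\<exists>X\<in>F. W - X = {j}" if j: "j \<in> W" for j
  proof -
    obtain X Y Z where XYZ: "X \<in> F" "Y \<in> F" "Z \<in> F" "W - {j} \<subseteq> X" "W - {j} \<subseteq> Y" "X \<subset> Z" "Y \<subset> Z"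
      "\<not> X \<subseteq> Y" "\<not> Y \<subseteq> X"
      using minimal_member_diff_bottom[OF W j] unfolding diamond_bottom_def by blast
    \<comment> \<open>If both middle sets contained \<open>j\<close>, they would contain
      \<open>W\<close>, and the member \<open>W\<close> would complete a diamond inside
      \<open>F\<close>.\<close>
    have "j \<notin> X \<or> j \<notin> Y"
    proof (rule ccontr)
      assume "\<not> (j \<notin> X \<or> j \<notin> Y)"
      then have "W \<subseteq> X" "W \<subseteq> Y" using XYZ by auto
      then have "diamond_bottom F W" using XYZ unfolding diamond_bottom_def by blast
      then show False using diamond_free_not_bottom[OF diamond_free WF] by simp
    qed
    then have "W - X = {j} \<or> W - Y = {j}" using XYZ(4,5) j by blast
    then show ?thesis using XYZ(1,2) by blast
  qed
  then obtain g where g: "\<And>j. j \<in> W \<Longrightarrow> g j \<in> F \<and> W - g j = {j}" by metis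
  have "inj_on g W" by (rule inj_onI) (metis g singleton_inject)
  then show ?thesis using card_inj_on_le[of g W F] g finite_members by blast
qed

text \<open>By maximality \<open>insert i M\<close> is not a bottom, so it contains a minimal
  member. That member is not inside \<open>M\<close>, because subsets of a bottom are bottoms and
  members are not.\<close>

lemma minimal_member_meets_maximal_bottom:
  assumes M: "diamond_bottom F M" and maxM: "\<forall>S. diamond_bottom F S \<longrightarrow> M \<subseteq> S \<longrightarrow> S = M"
    and i: "i \<in> {1..n} - M"
  shows "\<exists>W\<in>minimal_members F. W - M = {i}"
proof -
  have "\<not> diamond_bottom F (insert i M)" using maxM i by blast
  moreover have "insert i M \<subseteq> {1..n}"
    using M i members_subset unfolding diamond_bottom_def by blast
  ultimately obtain W where W: "W \<in> minimal_members F" "W \<subseteq> insert i M"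
    using non_bottom_above_minimal_member by blast
  have "\<not> W \<subseteq> M"
    using diamond_bottom_antimono[OF M] diamond_free_not_bottom[OF diamond_free] W(1)
      minimal_members_subset[of F] by blast
  then have "W - M = {i}" using W(2) by blast
  then show ?thesis using W(1) by blast
qed

lemma card_maximal_bottom:
  assumes M: "diamond_bottom F M" and maxM: "\<forall>S. diamond_bottom F S \<longrightarrow> M \<subseteq> S \<longrightarrow> S = M"
  shows "n - card F \<le> card M"
proof -
  have MN: "M \<subseteq> {1..n}" using M members_subset unfolding diamond_bottom_def by blast
  have "\<exists>W\<in>F. W - M = {i}" if "i \<in> {1..n} - M" for i
    using minimal_member_meets_maximal_bottom[OF M maxM that] minimal_members_subset[of F] by blast
  then obtain g where g: "\<And>i. i \<in> {1..n} - M \<Longrightarrow> g i \<in> F \<and> g i - M = {i}" by metis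
  have "inj_on g ({1..n} - M)" by (rule inj_onI) (metis g singleton_inject)
  then have "card ({1..n} - M) \<le> card F"
    using card_inj_on_le[of g _ F] g finite_members by blast
  then show ?thesis using MN by (simp add: card_Diff_subset finite_subset)
qed

text \<open>Remove \<open>i\<close> from a minimal member containing it and enlarge the result to a
  maximal bottom \<open>M\<close>, which still misses \<open>i\<close>. The set \<open>X\<close> is
  a middle set above \<open>M\<close> that misses \<open>i\<close>: it is large because
  \<open>M\<close> is, and non-maximal because it lies below a top.\<close>

lemma minimal_large_pair:
  assumes i: "i \<in> \<Union> (minimal_members F)"
  shows "\<exists>W\<in>minimal_members F. \<exists>X\<in>{X \<in> F - maximal_members F. n - card F \<le> card X}. W - X = {i}"
proof -
  obtain W0 where W0: "W0 \<in> minimal_members F" "i \<in> W0" using i by blast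
  let ?Bs = "{S. diamond_bottom F S}"
  have "?Bs \<subseteq> Pow {1..n}" using members_subset unfolding diamond_bottom_def by blast
  then have finB: "finite ?Bs" by (rule finite_subset) simp
  have "W0 - {i} \<in> ?Bs" using minimal_member_diff_bottom[OF W0] by simp
  then obtain M where M: "diamond_bottom F M" "W0 - {i} \<subseteq> M"
    and "\<forall>S\<in>?Bs. M \<subseteq> S \<longrightarrow> M = S"
    using finite_has_maximal2[OF finB] by blast
  then have maxM: "\<forall>S. diamond_bottom F S \<longrightarrow> M \<subseteq> S \<longrightarrow> S = M" by blast
  have iM: "i \<notin> M"
  proof
    assume "i \<in> M"
    then have "W0 \<subseteq> M" using M(2) by blast
    then have "diamond_bottom F W0" by (rule diamond_bottom_antimono[OF M(1)])
    then show False
      using W0(1) diamond_free_not_bottom[OF diamond_free] by (simp add: minimal_members_def)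
  qed
  have "i \<in> {1..n}" using W0 members_subset minimal_members_subset[of F] by blast
  then have "i \<in> {1..n} - M" using iM by simp
  from minimal_member_meets_maximal_bottom[OF M(1) maxM this]
  obtain W where W: "W \<in> minimal_members F" "W - M = {i}" by (elim bexE)
  obtain X Y Z where XYZ: "X \<in> F" "Y \<in> F" "Z \<in> F" "M \<subseteq> X" "M \<subseteq> Y" "X \<subset> Z" "Y \<subset> Z"
    "\<not> X \<subseteq> Y" "\<not> Y \<subseteq> X"
    using M(1) unfolding diamond_bottom_def by blast
  \<comment> \<open>\<open>X \<inter> Y\<close> is a bottom containing \<open>M\<close>, hence equal
    to \<open>M\<close>; so \<open>i\<close> is missing from \<open>X\<close> or from
    \<open>Y\<close>.\<close>
  have "diamond_bottom F (X \<inter> Y)" using XYZ unfolding diamond_bottom_def by blast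
  then have "X \<inter> Y = M" using maxM XYZ by blast
  then obtain V where V: "V \<in> F" "M \<subseteq> V" "V \<subset> Z" "i \<notin> V" using iM XYZ by blast
  have "card M \<le> card V" using card_mono[OF finite_member] V by blast
  then have "n - card F \<le> card V" using card_maximal_bottom[OF M(1) maxM] by linarith
  moreover have "V \<notin> maximal_members F" using V XYZ(3) by (auto simp: maximal_members_def)
  moreover have "W - V = {i}" using W(2) V by blast
  ultimately show ?thesis using V(1) W(1) by blast
qed

text \<open>The pair \<open>(W, X)\<close> determines \<open>i\<close> through
  \<open>W - X = {i}\<close>.\<close>

lemma card_Union_minimal_members:
  "card (\<Union> (minimal_members F)) \<le>
     card (minimal_members F) * card {X \<in> F - maximal_members F. n - card F \<le> card X}"
  (is "card ?U \<le> card ?A * card ?L")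
proof -
  obtain w x where wx: "\<And>i. i \<in> ?U \<Longrightarrow> w i \<in> ?A \<and> x i \<in> ?L \<and> w i - x i = {i}"
    using minimal_large_pair by metis
  have "inj_on (\<lambda>i. (w i, x i)) ?U"
    by (rule inj_onI) (metis wx singleton_inject prod.inject)
  moreover have "(\<lambda>i. (w i, x i)) ` ?U \<subseteq> ?A \<times> ?L" using wx by blast
  moreover have "finite (?A \<times> ?L)" using finite_members by (simp add: minimal_members_def)
  ultimately have "card ?U \<le> card (?A \<times> ?L)" by (rule card_inj_on_le)
  then show ?thesis by (simp add: card_cartesian_product)
qed

section \<open>Points in no minimal member\<close>

text \<open>One step of a climb through members missing \<open>i\<close>: either \<open>i\<close>
  can be added alone to \<open>P\<close>, or the climb continues to a larger \<open>X\<close>. Each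
  set reached after the start \<open>W\<close> stays below some member containing \<open>i\<close>;
  the alternative \<open>P = W\<close> admits the start.\<close>

lemma insert_member_or_extend:
  assumes W: "W \<in> minimal_members F" and i: "i \<in> {1..n} - \<Union> (minimal_members F)"
    and P: "P \<in> F" "i \<notin> P" "P = W \<or> (\<exists>Z\<in>F. insert i P \<subseteq> Z)"
  shows "insert i P \<in> F \<or> (\<exists>X\<in>F. P \<subset> X \<and> i \<notin> X \<and> (\<exists>Z\<in>F. insert i X \<subseteq> Z))"
proof (cases "insert i P \<in> F")
  case False
  \<comment> \<open>Minimal members avoid \<open>i\<close>, so one below \<open>S\<close> already
    lies in \<open>P\<close>; if \<open>P = W\<close>, minimality makes it equal to
    \<open>W\<close>.\<close>
  have low: "\<exists>V\<in>F. V \<subseteq> S \<and> V \<subseteq> P \<and> (P = W \<longrightarrow> V = W)" if S: "S \<in> F" "S \<subseteq> insert i P" for S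
  proof -
    obtain V where V: "V \<in> minimal_members F" "V \<subseteq> S" using minimal_member_below[OF S(1)] .
    then have "V \<subseteq> P" using S i by blast
    moreover have "V = W" if "P = W"
      using V W that \<open>V \<subseteq> P\<close> unfolding minimal_members_def by blast
    ultimately show ?thesis using V minimal_members_subset[of F] by blast
  qed
  have "insert i P \<subseteq> {1..n}" using P(1) i members_subset by blast
  from this False show ?thesis
  proof (cases rule: nonmember_cases)
    case bottom
    then have "diamond_bottom F P" by (rule diamond_bottom_antimono) blast
    then show ?thesis using diamond_free_not_bottom[OF diamond_free P(1)] by simp
  next
    case (middle W' X Z)
    obtain V where V: "V \<in> F" "V \<subseteq> W'" "V \<subseteq> P" using low[of W'] middle by blast
    \<comment> \<open>Both sets lie between \<open>V\<close> and \<open>Z\<close>. As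
      \<open>X\<close> is incomparable with \<open>insert i P\<close>, only
      \<open>P \<subset> X\<close> with \<open>i \<notin> X\<close> survives, and \<open>Z\<close>
      contains \<open>insert i X\<close>.\<close>
    have "P \<subseteq> X \<or> X \<subseteq> P"
      by (rule diamond_free_interval_chain[OF diamond_free V(1) P(1) _ \<open>Z \<in> F\<close>])
        (use V middle in auto)
    then have "P \<subset> X" "i \<notin> X" using middle by auto
    then show ?thesis using middle by blast
  next
    case (top W' X Y)
    \<comment> \<open>Such an \<open>S\<close> would be comparable with \<open>P\<close>, which is
      impossible: it contains \<open>i\<close> but not all of \<open>insert i P\<close>. For
      \<open>P = W\<close> comparability comes from \<open>V = W\<close>, otherwise from the common
      upper bound \<open>Z\<close>.\<close>
    have no: "\<not> (i \<in> S \<and> W' \<subset> S \<and> S \<subset> insert i P)" if "S \<in> F" for S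
    proof
      assume S: "i \<in> S \<and> W' \<subset> S \<and> S \<subset> insert i P"
      obtain V where V: "V \<in> F" "V \<subseteq> W'" "V \<subseteq> P" "P = W \<longrightarrow> V = W" using low[of W'] top by blast
      have "P \<subseteq> S \<or> S \<subseteq> P"
      proof (cases "P = W")
        case True
        then show ?thesis using V S by blast
      next
        case False
        then obtain Z where Z: "Z \<in> F" "insert i P \<subseteq> Z" using P(3) by blast
        have "V \<subseteq> S" "P \<subseteq> Z" "S \<subseteq> Z" using V(2) S Z(2) by auto
        then show ?thesis
          by (rule diamond_free_interval_chain[OF diamond_free V(1) P(1) that Z(1) V(3)])
      qed
      then show False using S P(2) by blast
    qed
    \<comment> \<open>Otherwise \<open>W'\<close>, \<open>X\<close>, \<open>Y\<close> and
      \<open>P\<close> would form a diamond in \<open>F\<close>.\<close>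
    have "i \<in> X \<or> i \<in> Y"
    proof (rule ccontr)
      assume "\<not> (i \<in> X \<or> i \<in> Y)"
      then have "X \<subseteq> P" "Y \<subseteq> P" using top by auto
      then have "X \<subseteq> Y \<or> Y \<subseteq> X"
        by (intro diamond_free_interval_chain[OF diamond_free \<open>W' \<in> F\<close> \<open>X \<in> F\<close> \<open>Y \<in> F\<close> P(1)])
          (use top in auto)
      then show False using top by simp
    qed
    then show ?thesis using no[of X] no[of Y] top by blast
  qed
qed simp

lemma card_outside_Union_minimal_members: "card ({1..n} - \<Union> (minimal_members F)) \<le> card F"
proof -
  let ?K = "{1..n} - \<Union> (minimal_members F)"
  obtain W where W: "W \<in> minimal_members F" using nonempty minimal_member_below by blast
  then have WF: "W \<in> F" by (simp add: minimal_members_def)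
  have "\<exists>P\<in>F. W \<subseteq> P \<and> i \<notin> P \<and> insert i P \<in> F" if i: "i \<in> ?K" for i
  proof -
    \<comment> \<open>The sets a climb from \<open>W\<close> may visit. At a maximal one no
      continuation exists, so \<open>i\<close> can be added.\<close>
    let ?Ps = "{P \<in> F. W \<subseteq> P \<and> i \<notin> P \<and> (P = W \<or> (\<exists>Z\<in>F. insert i P \<subseteq> Z))}"
    have fin: "finite ?Ps" using finite_members by simp
    have "W \<in> ?Ps" using W WF i by auto
    from finite_has_maximal2[OF fin this] obtain P where P: "P \<in> ?Ps"
      and maxP: "\<forall>Q\<in>?Ps. P \<subseteq> Q \<longrightarrow> P = Q" by (elim bexE conjE)
    have "\<not> (\<exists>X\<in>F. P \<subset> X \<and> i \<notin> X \<and> (\<exists>Z\<in>F. insert i X \<subseteq> Z))"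
    proof
      assume "\<exists>X\<in>F. P \<subset> X \<and> i \<notin> X \<and> (\<exists>Z\<in>F. insert i X \<subseteq> Z)"
      then obtain X where X: "X \<in> F" "P \<subset> X" "i \<notin> X" "\<exists>Z\<in>F. insert i X \<subseteq> Z" by blast
      then have "X \<in> ?Ps" using P by auto
      then show False using maxP X(2) by blast
    qed
    then have "insert i P \<in> F" using insert_member_or_extend[OF W i, of P] P by blast
    then show ?thesis using P by blast
  qed
  then obtain p where p: "\<And>i. i \<in> ?K \<Longrightarrow> p i \<in> F \<and> W \<subseteq> p i \<and> i \<notin> p i \<and> insert i (p i) \<in> F"
    by metis
  \<comment> \<open>If \<open>i\<close> and \<open>j\<close> share an image, \<open>p i\<close> and
    \<open>p j\<close> both lie between \<open>W\<close> and it and are comparable, yet each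
    contains the point the other misses.\<close>
  have "inj_on (\<lambda>i. insert i (p i)) ?K"
  proof (rule inj_onI, rule ccontr)
    fix i j assume ij: "i \<in> ?K" "j \<in> ?K" "insert i (p i) = insert j (p j)" "i \<noteq> j"
    have "p i \<subseteq> p j \<or> p j \<subseteq> p i"
      by (rule diamond_free_interval_chain[OF diamond_free WF, of _ _ "insert i (p i)"])
        (use p[OF ij(1)] p[OF ij(2)] ij(3) in auto)
    moreover have "i \<in> p j" "j \<in> p i" using ij(3,4) by (metis insertE insertI1)+
    ultimately show False using p[OF ij(1)] p[OF ij(2)] by blast
  qed
  then show ?thesis
    by (rule card_inj_on_le) (use p finite_members in auto)
qed

lemma card_minimal_times_large:
  "n - card F \<le> card (minimal_members F) * card {X \<in> F - maximal_members F. n - card F \<le> card X}"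
proof -
  let ?U = "\<Union> (minimal_members F)"
  have U: "?U \<subseteq> {1..n}" using members_subset minimal_members_subset[of F] by blast
  then have "card ({1..n} - ?U) = n - card ?U" by (simp add: card_Diff_subset finite_subset)
  then have "n - card F \<le> card ?U" using card_outside_Union_minimal_members by linarith
  then show ?thesis using card_Union_minimal_members by linarith
qed

end

section \<open>Combining the two product bounds\<close>

lemma card_sq_ge_of_saturated:
  assumes sat: "diamond_saturated n F" and small: "2 * card F < n"
  shows "16 * (n - card F) \<le> (card F)\<^sup>2"
proof -
  interpret saturated_family n F using sat by unfold_locales
  let ?c = "(-) {1..n}"
  interpret dual: saturated_family n "?c ` F"
    using diamond_saturated_complement[OF sat] by unfold_locales
  have injc: "inj_on ?c (Pow {1..n})" by (rule inj_onI) blast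
  have cardc: "card (?c ` G) = card G" if "G \<subseteq> F" for G
    using card_image inj_on_subset[OF injc] that members_subset by (meson subset_trans)
  have cardS: "card (?c S) = n - card S" "card S \<le> n" if "S \<in> F" for S
    using that members_subset card_mono[of "{1..n}" S]
    by (auto simp: card_Diff_subset finite_member)
  let ?f = "card F"
  let ?A = "minimal_members F" and ?B = "maximal_members F"
  let ?L = "{X \<in> F - ?B. n - ?f \<le> card X}" and ?L' = "{X \<in> F - ?A. card X \<le> ?f}"
  have subs: "?A \<subseteq> F" "?B \<subseteq> F" "?L \<subseteq> F" "?L' \<subseteq> F"
    using minimal_members_subset[of F] maximal_members_subset[of F] by blast+
  have fle: "?f \<le> n" using small by simp
  \<comment> \<open>Complements turn the large non-maximal members of the dual family into small
    non-minimal members of \<open>F\<close>; \<open>fle\<close> keeps the truncated subtraction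
    exact.\<close>
  have imgL: "{X \<in> ?c ` F - ?c ` ?A. n - ?f \<le> card X} \<subseteq> ?c ` ?L'"
  proof
    fix X assume "X \<in> {X \<in> ?c ` F - ?c ` ?A. n - ?f \<le> card X}"
    then obtain S where S: "S \<in> F" "X = ?c S" "S \<notin> ?A" "n - ?f \<le> card (?c S)" by blast
    then have "card S \<le> ?f" using cardS[of S] fle by linarith
    then show "X \<in> ?c ` ?L'" using S by blast
  qed
  have A_small: "card W \<le> ?f" if "W \<in> ?A" for W using card_minimal_member that .
  have B_large: "n - ?f \<le> card Z" if Z: "Z \<in> ?B" for Z
  proof -
    have "?c Z \<in> minimal_members (?c ` F)"
      unfolding minimal_members_complement[OF members_subset] using Z by (rule imageI)
    then have "card (?c Z) \<le> ?f" using dual.card_minimal_member cardc[of F] by fastforce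
    then show ?thesis using cardS[of Z] Z subs(2) by fastforce
  qed
  have lower: "n - ?f \<le> card ?A * card ?L" by (rule card_minimal_times_large)
  have fin: "finite (?c ` ?L')" using finite_members by simp
  have "n - ?f \<le> card (?c ` ?B) * card {X \<in> ?c ` F - ?c ` ?A. n - ?f \<le> card X}"
    using dual.card_minimal_times_large
    unfolding cardc[OF subset_refl] minimal_members_complement[OF members_subset]
      maximal_members_complement[OF members_subset] .
  also have "\<dots> \<le> card ?B * card ?L'"
    using card_mono[OF fin imgL] cardc[OF subs(2)] cardc[OF subs(4)] by simp
  finally have upper: "n - ?f \<le> card ?B * card ?L'" .
  have fins: "finite ?A" "finite ?B" "finite ?L" "finite ?L'"
    using subs finite_members finite_subset by blast+
  have "?A \<inter> ?L' = {}" "?B \<inter> ?L = {}" by auto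
  then have "card (?A \<union> ?L') = card ?A + card ?L'" "card (?B \<union> ?L) = card ?B + card ?L"
    using fins card_Un_disjoint by blast+
  \<comment> \<open>Sets on the left have at most \<open>?f\<close> points, those on the right at
    least \<open>n - ?f\<close>, and \<open>small\<close> separates these sizes.\<close>
  moreover have "(?A \<union> ?L') \<inter> (?B \<union> ?L) = {}"
  proof (rule ccontr)
    assume "(?A \<union> ?L') \<inter> (?B \<union> ?L) \<noteq> {}"
    then obtain S where "S \<in> ?A \<union> ?L'" "S \<in> ?B \<union> ?L" by blast
    then have "card S \<le> ?f" "n - ?f \<le> card S" using A_small B_large by auto
    then show False using small by linarith
  qed
  then have "card ((?A \<union> ?L') \<union> (?B \<union> ?L)) = card (?A \<union> ?L') + card (?B \<union> ?L)"
    using fins by (intro card_Un_disjoint) auto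
  moreover have "card ((?A \<union> ?L') \<union> (?B \<union> ?L)) \<le> ?f"
    using subs by (intro card_mono finite_members) blast
  ultimately have total: "(card ?A + card ?L) + (card ?B + card ?L') \<le> ?f" by linarith
  have amgm: "4 * real (a * b) \<le> (real a + real b)\<^sup>2" for a b :: nat
    using zero_le_power2[of "real a - real b"] by (simp add: power2_eq_square algebra_simps)
  define r where "r = sqrt (real (n - ?f))"
  have r: "r \<ge> 0" "r\<^sup>2 = real (n - ?f)" by (simp_all add: r_def)
  have half: "2 * r \<le> real a + real b" if "n - ?f \<le> a * b" for a b
  proof (rule power2_le_imp_le)
    have "(2 * r)\<^sup>2 = 4 * real (n - ?f)" using r by (simp add: power_mult_distrib)
    also have "\<dots> \<le> 4 * real (a * b)" using that by (simp only: of_nat_le_iff mult_le_cancel_left_pos zero_less_numeral)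
    also have "\<dots> \<le> (real a + real b)\<^sup>2" by (rule amgm)
    finally show "(2 * r)\<^sup>2 \<le> (real a + real b)\<^sup>2" .
  qed simp
  have "4 * r \<le> real ?f" using half[OF lower] half[OF upper] total by linarith
  then have "(4 * r)\<^sup>2 \<le> (real ?f)\<^sup>2" by (rule power_mono) (use r in simp)
  then have "real (16 * (n - ?f)) \<le> real (?f\<^sup>2)" using r by (simp add: power_mult_distrib)
  then show ?thesis by (simp only: of_nat_le_iff)
qed

section \<open>Asymptotic form\<close>

theorem theorem2:
  fixes c :: real
  assumes "c < 4"
  shows "\<exists>n0::nat. \<forall>n\<ge>n0. real (sat_star_diamond n) \<ge> c * sqrt (real n)"
proof (cases "c \<le> 0")
  case True
  then have "c * sqrt (real n) \<le> real (sat_star_diamond n)" for n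
    by (meson mult_nonpos_nonneg of_nat_0_le_iff order_trans real_sqrt_ge_zero)
  then show ?thesis by blast
next
  case False
  then have c: "c > 0" by simp
  have "c\<^sup>2 < 4\<^sup>2" using assms c by (intro power_strict_mono) auto
  then have gap: "16 - c\<^sup>2 > 0" by simp
  \<comment> \<open>For \<open>sqrt n > t\<close>, the first entry turns
    \<open>card F < c * sqrt n\<close> into \<open>2 * card F < n\<close>; the second contradicts
    the bound \<open>(16 - c\<^sup>2) * s < 16 * c\<close> reached at the end.\<close>
  define t where "t = max (2 * c) (16 * c / (16 - c\<^sup>2))"
  obtain n0 :: nat where n0: "t\<^sup>2 < real n0" using reals_Archimedean2 by blast
  have "c * sqrt (real n) \<le> real (sat_star_diamond n)" if n: "n \<ge> n0" for n
  proof (rule ccontr)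
    assume less: "\<not> ?thesis"
    have "sat_star_diamond n \<in> {card F | F. diamond_saturated n F}"
      unfolding sat_star_diamond_def
      by (rule Min_in[OF finite_card_diamond_saturated card_diamond_saturated_nonempty])
    then obtain F where F: "diamond_saturated n F" "sat_star_diamond n = card F" by blast
    define s where "s = sqrt (real n)"
    have s: "s \<ge> 0" "s\<^sup>2 = real n" by (simp_all add: s_def)
    have "t\<^sup>2 < s\<^sup>2" using n0 n s by simp
    then have "t < s" using s(1) by (rule power2_less_imp_less)
    then have ts: "2 * c < s" "16 * c / (16 - c\<^sup>2) < s" by (auto simp: t_def)
    have spos: "s > 0" using ts(1) c by linarith
    have f: "real (card F) < c * s" using less F(2) by (simp add: s_def)
    have "2 * c * s < s * s" using ts(1) spos by (intro mult_strict_right_mono)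
    then have "real (2 * card F) < real n" using f s by (simp add: power2_eq_square)
    then have small: "2 * card F < n" by (simp only: of_nat_less_iff)
    have "real (16 * (n - card F)) \<le> real ((card F)\<^sup>2)"
      using card_sq_ge_of_saturated[OF F(1) small] by (simp only: of_nat_le_iff)
    then have "16 * (s\<^sup>2 - real (card F)) \<le> (real (card F))\<^sup>2"
      using small s by simp
    also have "\<dots> \<le> (c * s)\<^sup>2" using f by (intro power_mono) auto
    finally have "(16 - c\<^sup>2) * s * s < 16 * c * s"
      using f by (simp add: power2_eq_square algebra_simps)
    then have "(16 - c\<^sup>2) * s < 16 * c" using spos by simp
    then show False using ts(2) gap by (simp add: field_simps)
  qed
  then show ?thesis by blast
qed

end
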